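(* Let $c\in\mathbb{Q}$ and let $p\ge5$ be a prime with $v_p(c)=0$. Write $\frac{E_4}{j-c}=\sum_{n\ge1}a_n\big(\frac{E_4}{j-c}\big)q^n$. Then \[ a_p\Big(\frac{E_4}{j-c}\Big)\equiv\big(c(c-1728)\big)^{\frac{p-1}{2}}\cdot\sum_{m=0}^{p-1}\frac{(6m)!}{(m!)^3(3m)!}\,c^{-m}\pmod p. \]
   Context: $q=e^{2\pi i z}$; $E_4=1+240\sum_{n\ge1}\sigma_3(n)q^n$ is the normalized weight-$4$ Eisenstein series and $j=q^{-1}+744+\cdots$ the modular $j$-invariant. The $q$-expansion of $E_4/(j-c)$ is the expansion at $\infty$ (equivalently the formal expansion $\sum_{m\ge0}c^m E_4 j^{-m-1}$, using $j^{-1}=q+O(q^2)$); its coefficients are integer polynomials in $c$. *)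

theory Defs
  imports "HOL-Computational_Algebra.Computational_Algebra"
begin

definition divisor_power_sum :: "nat \<Rightarrow> nat \<Rightarrow> nat" where
  "divisor_power_sum k n = (\<Sum>d | d dvd n. d ^ k)"

text \<open>Modular forms are represented by their expansions at the cusp infinity, as formal
  Laurent series over the rationals in the variable q.\<close>

definition E4 :: "rat fls" where
  "E4 = fps_to_fls (Abs_fps (\<lambda>n. if n = 0 then 1 else 240 * of_nat (divisor_power_sum 3 n)))"

definition E6 :: "rat fls" where
  "E6 = fps_to_fls (Abs_fps (\<lambda>n. if n = 0 then 1 else - 504 * of_nat (divisor_power_sum 5 n)))"

definition modular_discriminant :: "rat fls" where
  "modular_discriminant = (E4 ^ 3 - E6 ^ 2) / 1728"

definition j_invariant :: "rat fls" where
  "j_invariant = E4 ^ 3 / modular_discriminant"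

text \<open>The p-adic valuation on the rationals. It is only meaningful at nonzero arguments: the
  value at 0 is 0 here instead of infinity.\<close>

definition padic_val :: "nat \<Rightarrow> rat \<Rightarrow> int" where
  "padic_val p x =
     int (multiplicity (int p) (fst (quotient_of x))) -
     int (multiplicity (int p) (snd (quotient_of x)))"

text \<open>Congruence modulo p of rational numbers: the difference lies in the maximal ideal of
  the localization of the integers at p.\<close>

definition rat_cong :: "nat \<Rightarrow> rat \<Rightarrow> rat \<Rightarrow> bool" where
  "rat_cong p x y \<longleftrightarrow> x = y \<or> padic_val p (x - y) \<ge> 1"

end

theory Submission
  imports Defs
begin

text \<open>Put \<open>t = 1/j = q + O(q^2)\<close> and \<open>D = q d/dq\<close>. Ramanujan's differential equations, which follow
  from an elementary evaluation of convolutions of divisor sums, give \<open>D t = t E6/E4\<close> and the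
  hypergeometric expansion \<open>sqrt E4 = S(t)\<close> with \<open>S = \<Sum>m. (6m)!/((m!)^3 (3m)!) t^m\<close>. Hence
  \<open>E4/(j - c) = U(t) D t\<close> with \<open>U = S / (sqrt (1 - 1728 t) (1 - c t))\<close>. Integrating \<open>U\<close> termwise, all
  terms of degree below \<open>p\<close> contribute multiples of \<open>p\<close> to the coefficient of \<open>q^p\<close>, which is
  therefore congruent to the coefficient of \<open>t^(p-1)\<close> in \<open>U\<close>. Modulo \<open>p\<close>, the first \<open>p\<close> coefficients of
  \<open>S\<close> are those of a polynomial of degree at most \<open>p/6\<close>, and those of \<open>1/sqrt (1 - 1728 t)\<close> are those of
  \<open>(1 - 1728 t)^((p-1)/2)\<close>, so this coefficient is \<open>c^(p-1)\<close> times the value at \<open>t = 1/c\<close> of their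
  product.\<close>

section \<open>Convolutions of divisor sums\<close>

text \<open>The index set of a convolution of divisor sums at \<open>n\<close>: \<open>a\<close> and
  \<open>b\<close> are the divisors, \<open>x\<close> and \<open>y\<close> their cofactors.\<close>

definition quads :: "nat \<Rightarrow> (nat \<times> nat \<times> nat \<times> nat) set" where
  "quads n = {(a, b, x, y). 0 < a \<and> 0 < b \<and> 0 < x \<and> 0 < y \<and> a * x + b * y = n}"

lemma finite_quads [simp, intro]: "finite (quads n)"
proof (rule finite_subset)
  show "quads n \<subseteq> {..n} \<times> {..n} \<times> {..n} \<times> {..n}"
  proof (clarsimp simp: quads_def)
    fix a b x y :: nat
    assume "0 < a" "0 < b" "0 < x" "0 < y"
    then have "a \<le> a * x" "x \<le> a * x" "b \<le> b * y" "y \<le> b * y" by auto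
    then show "a \<le> a * x + b * y \<and> b \<le> a * x + b * y \<and> x \<le> a * x + b * y \<and> y \<le> a * x + b * y"
      by linarith
  qed
qed auto

lemma sum_quads_swap:
  "(\<Sum>(a, b, x, y)\<in>{z \<in> quads n. P z}. f a b x y) =
   (\<Sum>(a, b, x, y)\<in>{(a, b, x, y). (a, b, x, y) \<in> quads n \<and> P (b, a, y, x)}. f b a y x)"
  by (rule sum.reindex_bij_witness[where i = "\<lambda>(a, b, x, y). (b, a, y, x)"
        and j = "\<lambda>(a, b, x, y). (b, a, y, x)"]) (auto simp: quads_def add.commute)

text \<open>The map (a, b, x, y) to (a - b, b, x, x + y) stays inside \<open>quads n\<close> because
  (a - b) x + b (x + y) = a x + b y. The condition \<open>b < a\<close> keeps the first entry
  positive, and on the image the last entry exceeds \<open>x\<close>.\<close>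

lemma sum_quads_shear:
  "(\<Sum>(a, b, x, y)\<in>{(a, b, x, y). (a, b, x, y) \<in> quads n \<and> b < a}. f a b) =
   (\<Sum>(a, b, x, y)\<in>{(a, b, x, y). (a, b, x, y) \<in> quads n \<and> x < y}. f (a + b) b)"
proof (rule sum.reindex_bij_witness[where i = "\<lambda>(a, b, x, y). (a + b, b, x, y - x)"
        and j = "\<lambda>(a, b, x, y). (a - b, b, x, x + y)"], goal_cases)
  case (2 z)
  then obtain a b x y where z: "z = (a, b, x, y)" "(a, b, x, y) \<in> quads n" "b < a"
    by auto
  then obtain k where "a = b + k" "k > 0"
    using less_imp_add_positive by blast
  with z show ?case
    by (simp add: quads_def algebra_simps)
next
  case (4 z)
  then obtain a b x y where z: "z = (a, b, x, y)" "(a, b, x, y) \<in> quads n" "x < y"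
    by auto
  then obtain k where "y = x + k" "k > 0"
    using less_imp_add_positive by blast
  with z show ?case
    by (simp add: quads_def algebra_simps)
qed (auto simp: quads_def)

lemma sum_quads_trichotomy:
  fixes f :: "nat \<times> nat \<times> nat \<times> nat \<Rightarrow> rat" and k :: "nat \<times> nat \<times> nat \<times> nat \<Rightarrow> int"
  shows "sum f (quads n) = sum f {z \<in> quads n. k z > 0} + sum f {z \<in> quads n. k z < 0}
    + sum f {z \<in> quads n. k z = 0}"
proof -
  have "quads n = ({z \<in> quads n. k z > 0} \<union> {z \<in> quads n. k z < 0}) \<union> {z \<in> quads n. k z = 0}"
    by auto
  then have "sum f (quads n) = sum f (({z \<in> quads n. k z > 0} \<union> {z \<in> quads n. k z < 0}) \<union> {z \<in> quads n. k z = 0})"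
    by simp
  also have "\<dots> = sum f {z \<in> quads n. k z > 0} + sum f {z \<in> quads n. k z < 0}
    + sum f {z \<in> quads n. k z = 0}"
    by (subst sum.union_disjoint; (subst sum.union_disjoint)?) auto
  finally show ?thesis .
qed

text \<open>If a = b, then a (x + y) = n, so the common value is a divisor \<open>d\<close>, and
  \<open>x\<close> takes \<open>n div d - 1\<close> values.\<close>

lemma sum_quads_diag_left:
  fixes f :: "nat \<Rightarrow> rat"
  assumes "n > 0"
  shows "(\<Sum>(a, b, x, y)\<in>{(a, b, x, y). (a, b, x, y) \<in> quads n \<and> a = b}. f a) =
    (\<Sum>d | d dvd n. (of_nat (n div d) - 1) * f d)"
proof -
  have "(\<Sum>(a, b, x, y)\<in>{(a, b, x, y). (a, b, x, y) \<in> quads n \<and> a = b}. f a) =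
    (\<Sum>(d, x)\<in>Sigma {d. d dvd n} (\<lambda>d. {1..<n div d}). f d)"
  proof (rule sum.reindex_bij_witness[where j = "\<lambda>(a, b, x, y). (a, x)"
        and i = "\<lambda>(d, x). (d, d, x, n div d - x)"], goal_cases)
    case (1 z)
    then show ?case
      by (auto simp: quads_def simp flip: distrib_left)
  next
    case (2 z)
    then show ?case
      by (auto simp: quads_def simp flip: distrib_left)
  next
    case (4 z)
    then show ?case using assms
      by (auto simp: quads_def dvd_pos_nat simp flip: distrib_left)
  qed (auto simp: quads_def)
  also have "\<dots> = (\<Sum>d | d dvd n. (\<Sum>x\<in>{1..<n div d}. f d))"
    using assms by (subst sum.Sigma) auto
  also have "\<dots> = (\<Sum>d | d dvd n. (of_nat (n div d) - 1) * f d)"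
  proof (rule sum.cong)
    fix d assume "d \<in> {d. d dvd n}"
    then have "n div d \<ge> 1" using assms
      by (metis dvd_div_eq_0_iff less_one mem_Collect_eq not_gr0 not_le)
    then show "(\<Sum>x\<in>{1..<n div d}. f d) = (of_nat (n div d) - 1) * f d"
      by (simp add: of_nat_diff)
  qed simp
  finally show ?thesis .
qed

text \<open>If x = y, then (a + b) x = n, so \<open>a + b\<close> is a divisor \<open>d\<close>, and
  \<open>b\<close> takes each value from 1 to d - 1.\<close>

lemma sum_quads_diag_right:
  fixes f :: "nat \<Rightarrow> nat \<Rightarrow> rat"
  assumes "n > 0"
  shows "(\<Sum>(a, b, x, y)\<in>{(a, b, x, y). (a, b, x, y) \<in> quads n \<and> y = x}. f (a + b) b) =
    (\<Sum>d | d dvd n. \<Sum>b\<in>{1..<d}. f d b)"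
proof -
  have "(\<Sum>(a, b, x, y)\<in>{(a, b, x, y). (a, b, x, y) \<in> quads n \<and> y = x}. f (a + b) b) =
    (\<Sum>(d, b)\<in>Sigma {d. d dvd n} (\<lambda>d. {1..<d}). f d b)"
  proof (rule sum.reindex_bij_witness[where j = "\<lambda>(a, b, x, y). (a + b, b)"
        and i = "\<lambda>(d, b). (d - b, b, n div d, n div d)"], goal_cases)
    case (1 z)
    then show ?case
      by (auto simp: quads_def simp flip: distrib_right)
  next
    case (4 z)
    then show ?case using assms
      by (auto simp: quads_def dvd_pos_nat dvd_div_eq_0_iff simp flip: distrib_right
          intro!: Nat.gr0I)
  qed (auto simp: quads_def simp flip: distrib_right)
  also have "\<dots> = (\<Sum>d | d dvd n. \<Sum>b\<in>{1..<d}. f d b)"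
    using assms by (subst sum.Sigma) auto
  finally show ?thesis .
qed

text \<open>The substitution \<open>(a, b, x, y) \<mapsto> (a - b, b, x, x + y)\<close> carries the quadruples with \<open>a > b\<close> to
  those with \<open>x < y\<close>. For \<open>h\<close> invariant under the dihedral group of order 12 both halves can be
  completed by symmetry, so only the diagonals \<open>a = b\<close> and \<open>x = y\<close> remain.\<close>

lemma sum_quads_invariant:
  fixes h :: "nat \<Rightarrow> nat \<Rightarrow> rat"
  assumes sym: "\<And>a b. h a b = h b a" and inv: "\<And>a b. h (a + b) b = h (a + b) a"
    and n: "n > 0"
  shows "(\<Sum>(a, b, x, y)\<in>quads n. h a b - h (a + b) b) =
    (\<Sum>d | d dvd n. (of_nat (n div d) - 1) * h d d - (\<Sum>b\<in>{1..<d}. h d b))"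
proof -
  let ?A = "\<lambda>P. \<Sum>(a, b, x, y)\<in>{(a, b, x, y). (a, b, x, y) \<in> quads n \<and> P a b x y}. h a b"
  let ?B = "\<lambda>P. \<Sum>(a, b, x, y)\<in>{(a, b, x, y). (a, b, x, y) \<in> quads n \<and> P a b x y}. h (a + b) b"
  have set_eq: "{z \<in> quads n. P z} = {(a, b, x, y). (a, b, x, y) \<in> quads n \<and> P (a, b, x, y)}" for P
    by auto
  have A: "(\<Sum>(a, b, x, y)\<in>quads n. h a b) =
      ?A (\<lambda>a b x y. b < a) + ?A (\<lambda>a b x y. a < b) + ?A (\<lambda>a b x y. a = b)"
    using sum_quads_trichotomy[of "\<lambda>(a, b, x, y). h a b" n "\<lambda>(a, b, x, y). int a - int b"]
    by (simp add: set_eq)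
  have B: "(\<Sum>(a, b, x, y)\<in>quads n. h (a + b) b) =
      ?B (\<lambda>a b x y. x < y) + ?B (\<lambda>a b x y. y < x) + ?B (\<lambda>a b x y. y = x)"
    using sum_quads_trichotomy[of "\<lambda>(a, b, x, y). h (a + b) b" n "\<lambda>(a, b, x, y). int y - int x"]
    by (simp add: set_eq)
  have A': "?A (\<lambda>a b x y. a < b) = ?A (\<lambda>a b x y. b < a)"
    using sum_quads_swap[of "\<lambda>a b x y. h a b" n "\<lambda>(a, b, x, y). a < b"]
    by (simp add: set_eq sym)
  have B': "?B (\<lambda>a b x y. y < x) = ?B (\<lambda>a b x y. x < y)"
    using sum_quads_swap[of "\<lambda>a b x y. h (a + b) b" n "\<lambda>(a, b, x, y). y < x"]
    by (simp add: set_eq inv add.commute)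
  have AB: "?A (\<lambda>a b x y. b < a) = ?B (\<lambda>a b x y. x < y)"
    by (rule sum_quads_shear)
  have A0: "?A (\<lambda>a b x y. a = b) = (\<Sum>d | d dvd n. (of_nat (n div d) - 1) * h d d)"
  proof -
    have "?A (\<lambda>a b x y. a = b) =
      (\<Sum>(a, b, x, y)\<in>{(a, b, x, y). (a, b, x, y) \<in> quads n \<and> a = b}. h a a)"
      by (rule sum.cong) auto
    then show ?thesis
      by (simp add: sum_quads_diag_left[OF n, of "\<lambda>a. h a a"])
  qed
  have B0: "?B (\<lambda>a b x y. y = x) = (\<Sum>d | d dvd n. \<Sum>b\<in>{1..<d}. h d b)"
    by (rule sum_quads_diag_right[OF n])
  have "(\<Sum>(a, b, x, y)\<in>quads n. h a b - h (a + b) b) =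
    (\<Sum>(a, b, x, y)\<in>quads n. h a b) - (\<Sum>(a, b, x, y)\<in>quads n. h (a + b) b)"
    by (simp add: case_prod_unfold sum_subtractf)
  also have "\<dots> = ?A (\<lambda>a b x y. a = b) - ?B (\<lambda>a b x y. y = x)"
    unfolding A B A' B' AB by simp
  also have "\<dots> = (\<Sum>d | d dvd n. (of_nat (n div d) - 1) * h d d - (\<Sum>b\<in>{1..<d}. h d b))"
    unfolding A0 B0 by (simp add: sum_subtractf)
  finally show ?thesis .
qed

lemma power_sums:
  fixes m :: nat
  defines "M \<equiv> of_nat m :: rat"
  assumes "m \<ge> 1"
  shows "(\<Sum>b\<in>{1..<m}. of_nat b) = M * (M - 1) / 2"
    and "(\<Sum>b\<in>{1..<m}. of_nat b ^ 2) = M * (M - 1) * (2 * M - 1) / 6"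
    and "(\<Sum>b\<in>{1..<m}. of_nat b ^ 3) = M ^ 2 * (M - 1) ^ 2 / 4"
    and "(\<Sum>b\<in>{1..<m}. of_nat b ^ 4) = M * (M - 1) * (2 * M - 1) * (3 * M ^ 2 - 3 * M - 1) / 30"
    and "(\<Sum>b\<in>{1..<m}. of_nat b ^ 5) = M ^ 2 * (M - 1) ^ 2 * (2 * M ^ 2 - 2 * M - 1) / 12"
    and "(\<Sum>b\<in>{1..<m}. of_nat b ^ 6) =
      M * (M - 1) * (2 * M - 1) * (3 * M ^ 4 - 6 * M ^ 3 + 3 * M + 1) / 42"
  unfolding M_def using \<open>m \<ge> 1\<close>
  by (induction m rule: dec_induct; simp add: field_simps power_numeral_reduce)+

section \<open>Products of the generating series of divisor sums\<close>

abbreviation sig :: "nat \<Rightarrow> nat \<Rightarrow> rat" where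
  "sig k n \<equiv> of_nat (divisor_power_sum k n)"

definition sigma_fps :: "nat \<Rightarrow> rat fps" where
  "sigma_fps k = Abs_fps (sig k)"

lemma sigma_fps_nth: "sigma_fps k $ n = (\<Sum>d | d dvd n. of_nat d ^ k)"
  by (simp add: sigma_fps_def divisor_power_sum_def)

text \<open>Every natural number divides 0, and a sum over an infinite set is 0 by convention; this
  default is the constant term wanted here.\<close>

lemma sigma_fps_nth_0 [simp]: "sigma_fps k $ 0 = 0"
  by (simp add: sigma_fps_nth)

text \<open>Writing i = a x and n - i = b y turns the Cauchy product into a sum over
  \<open>quads n\<close>; its two end terms vanish with the constant terms.\<close>

lemma sigma_fps_mult_nth:
  "(sigma_fps k * sigma_fps l) $ n = (\<Sum>(a, b, x, y)\<in>quads n. of_nat a ^ k * of_nat b ^ l)"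
proof -
  have "(sigma_fps k * sigma_fps l) $ n = (\<Sum>i\<in>{1..<n}. sigma_fps k $ i * sigma_fps l $ (n - i))"
    unfolding fps_mult_nth
  proof (rule sum.mono_neutral_right)
    show "\<forall>i\<in>{0..n} - {1..<n}. sigma_fps k $ i * sigma_fps l $ (n - i) = 0"
    proof
      fix i assume "i \<in> {0..n} - {1..<n}"
      then have "i = 0 \<or> n - i = 0" by auto
      then show "sigma_fps k $ i * sigma_fps l $ (n - i) = 0" by auto
    qed
  qed auto
  also have "\<dots> = (\<Sum>i\<in>{1..<n}. \<Sum>(a, b)\<in>{a. a dvd i} \<times> {b. b dvd n - i}. of_nat a ^ k * of_nat b ^ l)"
    by (simp add: sigma_fps_nth sum_product sum.cartesian_product)
  also have "\<dots> = (\<Sum>(i, a, b)\<in>Sigma {1..<n} (\<lambda>i. {a. a dvd i} \<times> {b. b dvd n - i}).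
      of_nat a ^ k * of_nat b ^ l)"
    by (subst sum.Sigma) auto
  also have "\<dots> = (\<Sum>(a, b, x, y)\<in>quads n. of_nat a ^ k * of_nat b ^ l)"
  proof (rule sum.reindex_bij_witness[where i = "\<lambda>(a, b, x, y). (a * x, a, b)"
        and j = "\<lambda>(i, a, b). (a, b, i div a, (n - i) div b)"], goal_cases)
    case (2 z)
    then show ?case
      by (auto simp: quads_def dvd_div_eq_0_iff intro!: Nat.gr0I)
  qed (auto simp: quads_def)
  finally show ?thesis .
qed

text \<open>For the invariants \<open>h\<close> built from \<open>h1\<close> and \<open>h4\<close>,
  \<open>h (a + b) b\<close> is the value of the polynomial at (a, -b), so
  \<open>h a b - h (a + b) b\<close> is twice its part odd in \<open>b\<close>. Up to symmetry this
  leaves one convolution in degrees 2 and 4 and two in degree 6, whence the choices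
  \<open>h1\<close>, \<open>h1 ^ 2\<close>, \<open>h4\<close> and \<open>h1 ^ 3\<close>.\<close>

lemma sigma_convolutions:
  assumes n: "n > 0"
  shows "12 * (sigma_fps 1 * sigma_fps 1) $ n = 5 * sig 3 n + (1 - 6 * of_nat n) * sig 1 n" (is ?t1)
    and "240 * (sigma_fps 1 * sigma_fps 3) $ n =
      21 * sig 5 n + (10 - 30 * of_nat n) * sig 3 n - sig 1 n" (is ?t2)
    and "120 * (sigma_fps 3 * sigma_fps 3) $ n = sig 7 n - sig 3 n" (is ?t3)
    and "504 * (sigma_fps 1 * sigma_fps 5) $ n =
      20 * sig 7 n + (21 - 42 * of_nat n) * sig 5 n + sig 1 n" (is ?t4)
proof -
  let ?D = "{d. d dvd n}"
  have sig: "sig k n = (\<Sum>d\<in>?D. of_nat d ^ k)" for k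
    by (simp add: divisor_power_sum_def)
  have D1: "d \<ge> 1" if "d \<in> ?D" for d
    using that n by (auto dest: dvd_pos_nat)
  have ndiv: "of_nat (n div d) * of_nat d = (of_nat n :: rat)" if "d \<in> ?D" for d
    using that by (simp flip: of_nat_mult)
  have swap: "(\<Sum>(a, b, x, y)\<in>quads n. of_nat a ^ k * of_nat b ^ l :: rat) =
     (\<Sum>(a, b, x, y)\<in>quads n. of_nat a ^ l * of_nat b ^ k)" for k l
    unfolding sigma_fps_mult_nth[symmetric] by (simp add: mult.commute)

  txt \<open>These two generate the polynomials invariant under the dihedral group.\<close>
  define h1 :: "nat \<Rightarrow> nat \<Rightarrow> rat" where
    "h1 = (\<lambda>a b. of_nat a ^ 2 - of_nat a * of_nat b + of_nat b ^ 2)"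
  define h4 :: "nat \<Rightarrow> nat \<Rightarrow> rat" where
    "h4 = (\<lambda>a b. (of_nat a * of_nat b * (of_nat a - of_nat b)) ^ 2)"
  have h1: "h1 a b = h1 b a" "h1 (a + b) b = h1 (a + b) a" for a b
    by (simp_all add: h1_def algebra_simps power2_eq_square)
  have h4: "h4 a b = h4 b a" "h4 (a + b) b = h4 (a + b) a" for a b
    by (simp_all add: h4_def algebra_simps power2_eq_square)

  have "(\<Sum>(a, b, x, y)\<in>quads n. h1 a b - h1 (a + b) b) =
    (\<Sum>d\<in>?D. (of_nat (n div d) - 1) * h1 d d - (\<Sum>b\<in>{1..<d}. h1 d b))"
    by (rule sum_quads_invariant) (use h1 n in auto)
  also have "(\<Sum>(a, b, x, y)\<in>quads n. h1 a b - h1 (a + b) b) =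
      (\<Sum>(a, b, x, y)\<in>quads n. - 2 * (of_nat a ^ 1 * of_nat b ^ 1))"
    by (rule sum.cong) (auto simp: h1_def algebra_simps power2_eq_square)
  also have "\<dots> = - 2 * (sigma_fps 1 * sigma_fps 1) $ n"
    by (simp add: sigma_fps_mult_nth sum_distrib_left case_prod_unfold)
  also have "(\<Sum>d\<in>?D. (of_nat (n div d) - 1) * h1 d d - (\<Sum>b\<in>{1..<d}. h1 d b)) =
     (\<Sum>d\<in>?D. of_nat n * of_nat d ^ 1 - 5 / 6 * of_nat d ^ 3 - 1 / 6 * of_nat d ^ 1)"
  proof (rule sum.cong)
    fix d assume d: "d \<in> ?D"
    have S: "(\<Sum>b\<in>{1..<d}. h1 d b) = of_nat d ^ 2 * (of_nat d - 1)
      - of_nat d * (\<Sum>b\<in>{1..<d}. of_nat b) + (\<Sum>b\<in>{1..<d}. of_nat b ^ 2)"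
      using D1[OF d] by (simp add: h1_def sum.distrib sum_subtractf sum_distrib_left of_nat_diff)
    \<comment> \<open>Since \<open>h1 d d\<close> is the square of \<open>d\<close>, one factor
      \<open>d\<close> combines with the cofactor \<open>n div d\<close> to give
      \<open>n\<close>.\<close>
    have N: "of_nat (n div d) * h1 d d = of_nat n * of_nat d"
      unfolding h1_def ndiv[OF d, symmetric] by (simp add: power2_eq_square)
    show "(of_nat (n div d) - 1) * h1 d d - (\<Sum>b\<in>{1..<d}. h1 d b) =
      of_nat n * of_nat d ^ 1 - 5 / 6 * of_nat d ^ 3 - 1 / 6 * of_nat d ^ 1"
      unfolding left_diff_distrib N S power_sums[OF D1[OF d]]
      by (simp add: h1_def field_simps power_numeral_reduce)
  qed simp
  also have "\<dots> = of_nat n * sig 1 n - 5 / 6 * sig 3 n - 1 / 6 * sig 1 n"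
    unfolding sig by (simp add: sum_subtractf sum_distrib_left)
  finally show ?t1 by (simp add: field_simps)

  have "(\<Sum>(a, b, x, y)\<in>quads n. h1 a b ^ 2 - h1 (a + b) b ^ 2) =
    (\<Sum>d\<in>?D. (of_nat (n div d) - 1) * h1 d d ^ 2 - (\<Sum>b\<in>{1..<d}. h1 d b ^ 2))"
    by (rule sum_quads_invariant[of "\<lambda>a b. h1 a b ^ 2"]) (use h1 n in auto)
  also have "(\<Sum>(a, b, x, y)\<in>quads n. h1 a b ^ 2 - h1 (a + b) b ^ 2) =
      (\<Sum>(a, b, x, y)\<in>quads n. - 4 * (of_nat a ^ 1 * of_nat b ^ 3) - 4 * (of_nat a ^ 3 * of_nat b ^ 1))"
    by (rule sum.cong) (auto simp: h1_def algebra_simps power_numeral_reduce)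
  also have "\<dots> = - 8 * (\<Sum>(a, b, x, y)\<in>quads n. of_nat a ^ 1 * of_nat b ^ 3)"
    using swap[of 3 1] by (simp add: sum_subtractf sum_negf sum_distrib_left[symmetric] case_prod_unfold)
  also have "\<dots> = - 8 * (sigma_fps 1 * sigma_fps 3) $ n"
    by (simp add: sigma_fps_mult_nth)
  also have "(\<Sum>d\<in>?D. (of_nat (n div d) - 1) * h1 d d ^ 2 - (\<Sum>b\<in>{1..<d}. h1 d b ^ 2)) =
     (\<Sum>d\<in>?D. of_nat n * of_nat d ^ 3 - 7 / 10 * of_nat d ^ 5 - 1 / 3 * of_nat d ^ 3
       + 1 / 30 * of_nat d ^ 1)"
  proof (rule sum.cong)
    fix d assume d: "d \<in> ?D"
    have "(\<Sum>b\<in>{1..<d}. h1 d b ^ 2) = (\<Sum>b\<in>{1..<d}. of_nat d ^ 4 - 2 * of_nat d ^ 3 * of_nat b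
       + 3 * of_nat d ^ 2 * of_nat b ^ 2 - 2 * of_nat d * of_nat b ^ 3 + of_nat b ^ 4)"
      by (rule sum.cong) (simp_all add: h1_def algebra_simps power_numeral_reduce)
    also have "\<dots> = of_nat d ^ 4 * (of_nat d - 1)
      - 2 * of_nat d ^ 3 * (\<Sum>b\<in>{1..<d}. of_nat b) + 3 * of_nat d ^ 2 * (\<Sum>b\<in>{1..<d}. of_nat b ^ 2)
      - 2 * of_nat d * (\<Sum>b\<in>{1..<d}. of_nat b ^ 3) + (\<Sum>b\<in>{1..<d}. of_nat b ^ 4)"
      using D1[OF d] by (simp add: sum.distrib sum_subtractf sum_distrib_left of_nat_diff)
    finally have S: "(\<Sum>b\<in>{1..<d}. h1 d b ^ 2) = \<dots>" .
    have N: "of_nat (n div d) * h1 d d ^ 2 = of_nat n * of_nat d ^ 3"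
      unfolding h1_def ndiv[OF d, symmetric] by (simp add: power_numeral_reduce)
    show "(of_nat (n div d) - 1) * h1 d d ^ 2 - (\<Sum>b\<in>{1..<d}. h1 d b ^ 2) =
      of_nat n * of_nat d ^ 3 - 7 / 10 * of_nat d ^ 5 - 1 / 3 * of_nat d ^ 3 + 1 / 30 * of_nat d ^ 1"
      unfolding left_diff_distrib N S power_sums[OF D1[OF d]]
      by (simp add: h1_def field_simps power_numeral_reduce)
  qed simp
  also have "\<dots> = of_nat n * sig 3 n - 7 / 10 * sig 5 n - 1 / 3 * sig 3 n + 1 / 30 * sig 1 n"
    unfolding sig by (simp add: sum_subtractf sum.distrib sum_distrib_left)
  finally show ?t2 by (simp add: field_simps)

  have "(\<Sum>(a, b, x, y)\<in>quads n. h4 a b - h4 (a + b) b) =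
    (\<Sum>d\<in>?D. (of_nat (n div d) - 1) * h4 d d - (\<Sum>b\<in>{1..<d}. h4 d b))"
    by (rule sum_quads_invariant) (use h4 n in auto)
  also have "(\<Sum>(a, b, x, y)\<in>quads n. h4 a b - h4 (a + b) b) =
      (\<Sum>(a, b, x, y)\<in>quads n. - 4 * (of_nat a ^ 3 * of_nat b ^ 3))"
    by (rule sum.cong) (auto simp: h4_def algebra_simps power_numeral_reduce)
  also have "\<dots> = - 4 * (sigma_fps 3 * sigma_fps 3) $ n"
    by (simp add: sigma_fps_mult_nth sum_distrib_left case_prod_unfold)
  also have "(\<Sum>d\<in>?D. (of_nat (n div d) - 1) * h4 d d - (\<Sum>b\<in>{1..<d}. h4 d b)) =
     (\<Sum>d\<in>?D. 1 / 30 * of_nat d ^ 3 - 1 / 30 * of_nat d ^ 7)"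
  proof (rule sum.cong)
    fix d assume d: "d \<in> ?D"
    have "(\<Sum>b\<in>{1..<d}. h4 d b) = (\<Sum>b\<in>{1..<d}. of_nat d ^ 4 * of_nat b ^ 2
       - 2 * of_nat d ^ 3 * of_nat b ^ 3 + of_nat d ^ 2 * of_nat b ^ 4)"
      by (rule sum.cong) (simp_all add: h4_def algebra_simps power_numeral_reduce)
    also have "\<dots> = of_nat d ^ 4 * (\<Sum>b\<in>{1..<d}. of_nat b ^ 2)
      - 2 * of_nat d ^ 3 * (\<Sum>b\<in>{1..<d}. of_nat b ^ 3) + of_nat d ^ 2 * (\<Sum>b\<in>{1..<d}. of_nat b ^ 4)"
      by (simp add: sum.distrib sum_subtractf sum_distrib_left)
    finally have S: "(\<Sum>b\<in>{1..<d}. h4 d b) = \<dots>" .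
    \<comment> \<open>\<open>h4\<close> vanishes on the diagonal, so no term with a factor
      \<open>n\<close> appears.\<close>
    show "(of_nat (n div d) - 1) * h4 d d - (\<Sum>b\<in>{1..<d}. h4 d b) =
      1 / 30 * of_nat d ^ 3 - 1 / 30 * of_nat d ^ 7"
      unfolding S power_sums[OF D1[OF d]]
      by (simp add: h4_def field_simps power_numeral_reduce)
  qed simp
  also have "\<dots> = 1 / 30 * sig 3 n - 1 / 30 * sig 7 n"
    unfolding sig by (simp add: sum_subtractf sum_distrib_left)
  finally show t3: ?t3 by (simp add: field_simps)

  have "(\<Sum>(a, b, x, y)\<in>quads n. h1 a b ^ 3 - h1 (a + b) b ^ 3) =
    (\<Sum>d\<in>?D. (of_nat (n div d) - 1) * h1 d d ^ 3 - (\<Sum>b\<in>{1..<d}. h1 d b ^ 3))"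
    by (rule sum_quads_invariant[of "\<lambda>a b. h1 a b ^ 3"]) (use h1 n in auto)
  also have "(\<Sum>(a, b, x, y)\<in>quads n. h1 a b ^ 3 - h1 (a + b) b ^ 3) =
      (\<Sum>(a, b, x, y)\<in>quads n. - 6 * (of_nat a ^ 1 * of_nat b ^ 5) - 6 * (of_nat a ^ 5 * of_nat b ^ 1)
        - 14 * (of_nat a ^ 3 * of_nat b ^ 3))"
    by (rule sum.cong) (auto simp: h1_def algebra_simps power_numeral_reduce)
  also have "\<dots> = - 12 * (\<Sum>(a, b, x, y)\<in>quads n. of_nat a ^ 1 * of_nat b ^ 5)
      - 14 * (\<Sum>(a, b, x, y)\<in>quads n. of_nat a ^ 3 * of_nat b ^ 3)"
    using swap[of 5 1] by (simp add: sum_subtractf sum_negf sum_distrib_left[symmetric] case_prod_unfold)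
  also have "\<dots> = - 12 * (sigma_fps 1 * sigma_fps 5) $ n - 14 * (sigma_fps 3 * sigma_fps 3) $ n"
    by (simp add: sigma_fps_mult_nth)
  also have "(\<Sum>d\<in>?D. (of_nat (n div d) - 1) * h1 d d ^ 3 - (\<Sum>b\<in>{1..<d}. h1 d b ^ 3)) =
     (\<Sum>d\<in>?D. of_nat n * of_nat d ^ 5 - 83 / 140 * of_nat d ^ 7 - 1 / 2 * of_nat d ^ 5
       + 7 / 60 * of_nat d ^ 3 - 1 / 42 * of_nat d ^ 1)"
  proof (rule sum.cong)
    fix d assume d: "d \<in> ?D"
    have "(\<Sum>b\<in>{1..<d}. h1 d b ^ 3) = (\<Sum>b\<in>{1..<d}. of_nat d ^ 6 - 3 * of_nat d ^ 5 * of_nat b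
       + 6 * of_nat d ^ 4 * of_nat b ^ 2 - 7 * of_nat d ^ 3 * of_nat b ^ 3
       + 6 * of_nat d ^ 2 * of_nat b ^ 4 - 3 * of_nat d * of_nat b ^ 5 + of_nat b ^ 6)"
      by (rule sum.cong) (simp_all add: h1_def algebra_simps power_numeral_reduce)
    also have "\<dots> = of_nat d ^ 6 * (of_nat d - 1)
      - 3 * of_nat d ^ 5 * (\<Sum>b\<in>{1..<d}. of_nat b) + 6 * of_nat d ^ 4 * (\<Sum>b\<in>{1..<d}. of_nat b ^ 2)
      - 7 * of_nat d ^ 3 * (\<Sum>b\<in>{1..<d}. of_nat b ^ 3)
      + 6 * of_nat d ^ 2 * (\<Sum>b\<in>{1..<d}. of_nat b ^ 4)
      - 3 * of_nat d * (\<Sum>b\<in>{1..<d}. of_nat b ^ 5) + (\<Sum>b\<in>{1..<d}. of_nat b ^ 6)"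
      using D1[OF d] by (simp add: sum.distrib sum_subtractf sum_distrib_left of_nat_diff)
    finally have S: "(\<Sum>b\<in>{1..<d}. h1 d b ^ 3) = \<dots>" .
    have N: "of_nat (n div d) * h1 d d ^ 3 = of_nat n * of_nat d ^ 5"
      unfolding h1_def ndiv[OF d, symmetric] by (simp add: power_numeral_reduce)
    show "(of_nat (n div d) - 1) * h1 d d ^ 3 - (\<Sum>b\<in>{1..<d}. h1 d b ^ 3) =
      of_nat n * of_nat d ^ 5 - 83 / 140 * of_nat d ^ 7 - 1 / 2 * of_nat d ^ 5
       + 7 / 60 * of_nat d ^ 3 - 1 / 42 * of_nat d ^ 1"
      unfolding left_diff_distrib N S power_sums[OF D1[OF d]]
      by (simp add: h1_def field_simps power_numeral_reduce)
  qed simp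
  also have "\<dots> = of_nat n * sig 5 n - 83 / 140 * sig 7 n - 1 / 2 * sig 5 n + 7 / 60 * sig 3 n - 1 / 42 * sig 1 n"
    unfolding sig by (simp add: sum_subtractf sum.distrib sum_distrib_left)
  \<comment> \<open>The cube of \<open>h1\<close> also produces the square of
    \<open>sigma_fps 3\<close>, which the previous identity eliminates.\<close>
  finally show ?t4 using t3 by (simp add: field_simps)
qed

section \<open>The hypergeometric differential equation\<close>

text \<open>Ramanujan's names for the Eisenstein series of weights 2, 4 and 6.\<close>

definition P_fps :: "rat fps" where "P_fps = 1 - 24 * sigma_fps 1"
definition Q_fps :: "rat fps" where "Q_fps = 1 + 240 * sigma_fps 3"
definition R_fps :: "rat fps" where "R_fps = 1 - 504 * sigma_fps 5"

definition qd :: "rat fps \<Rightarrow> rat fps" where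
  "qd g = fps_X * fps_deriv g"

lemma qd_nth [simp]: "qd g $ n = of_nat n * g $ n"
  by (cases n) (auto simp: qd_def)

lemma qd_simps:
  "qd (f + g) = qd f + qd g" "qd (f - g) = qd f - qd g" "qd (f * g) = qd f * g + f * qd g"
  "qd (numeral k) = 0" "qd 1 = 0"
  by (simp_all add: qd_def algebra_simps)

lemma fps_numeral_mult_nth:
  "(numeral k * f :: rat fps) $ n = numeral k * f $ n"
  "(f * numeral k :: rat fps) $ n = f $ n * numeral k"
  by (simp_all add: numeral_fps_const)

lemma PQR_nth_0 [simp]: "P_fps $ 0 = 1" "Q_fps $ 0 = 1" "R_fps $ 0 = 1"
  by (simp_all add: P_fps_def Q_fps_def R_fps_def fps_numeral_mult_nth)

text \<open>Beyond the constant terms these are the convolution identities. In the third equation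
  the divisor sums of exponent 7 cancel, as 12096 (20/504) = 57600/120.\<close>

lemma ramanujan:
  "12 * qd P_fps = P_fps ^ 2 - Q_fps"
  "3 * qd Q_fps = P_fps * Q_fps - R_fps"
  "2 * qd R_fps = P_fps * R_fps - Q_fps ^ 2"
proof -
  have nth: "sigma_fps k $ n = sig k n" for k n
    by (simp add: sigma_fps_def)
  have "(12 * qd P_fps) $ n = (P_fps ^ 2 - Q_fps) $ n" for n
  proof (cases "n = 0")
    case False
    define c where "c = sigma_fps 1 * sigma_fps 1"
    have "P_fps ^ 2 - Q_fps = - 48 * sigma_fps 1 + 576 * c - 240 * sigma_fps 3"
      by (simp add: P_fps_def Q_fps_def c_def algebra_simps power2_eq_square)
    with False sigma_convolutions(1)[of n, folded c_def] show ?thesis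
      by (simp only:) (simp add: P_fps_def fps_numeral_mult_nth nth algebra_simps)
  qed (simp add: fps_numeral_mult_nth fps_power_zeroth)
  then show "12 * qd P_fps = P_fps ^ 2 - Q_fps"
    by (rule fps_ext)
  have "(3 * qd Q_fps) $ n = (P_fps * Q_fps - R_fps) $ n" for n
  proof (cases "n = 0")
    case False
    define c where "c = sigma_fps 1 * sigma_fps 3"
    have "P_fps * Q_fps - R_fps =
      240 * sigma_fps 3 - 24 * sigma_fps 1 - 5760 * c + 504 * sigma_fps 5"
      by (simp add: P_fps_def Q_fps_def R_fps_def c_def algebra_simps power2_eq_square)
    with False sigma_convolutions(2)[of n, folded c_def] show ?thesis
      by (simp only:) (simp add: Q_fps_def fps_numeral_mult_nth nth algebra_simps)
  qed (simp add: fps_numeral_mult_nth fps_power_zeroth)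
  then show "3 * qd Q_fps = P_fps * Q_fps - R_fps"
    by (rule fps_ext)
  have "(2 * qd R_fps) $ n = (P_fps * R_fps - Q_fps ^ 2) $ n" for n
  proof (cases "n = 0")
    case False
    define c where "c = sigma_fps 1 * sigma_fps 5"
    define c' where "c' = sigma_fps 3 * sigma_fps 3"
    have "P_fps * R_fps - Q_fps ^ 2 = 12096 * c - 24 * sigma_fps 1
       - 504 * sigma_fps 5 - 480 * sigma_fps 3 - 57600 * c'"
      by (simp add: P_fps_def Q_fps_def R_fps_def c_def c'_def algebra_simps power2_eq_square)
    with False sigma_convolutions(3,4)[of n, folded c_def c'_def] show ?thesis
      by (simp only:) (simp add: R_fps_def fps_numeral_mult_nth nth algebra_simps)
  qed (simp add: fps_numeral_mult_nth fps_power_zeroth)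
  then show "2 * qd R_fps = P_fps * R_fps - Q_fps ^ 2"
    by (rule fps_ext)
qed

text \<open>\<open>t_fps\<close> is \<open>1/j\<close>, \<open>w_fps\<close> is \<open>1/(1 - 1728 t)\<close>, and \<open>theta\<close> is the derivation \<open>t d/dt\<close>.\<close>

definition t_fps :: "rat fps" where
  "t_fps = fps_const (1 / 1728) * (Q_fps ^ 3 - R_fps ^ 2) * inverse (Q_fps ^ 3)"

definition sqrt_E4 :: "rat fps" where
  "sqrt_E4 = fps_binomial (1 / 2) oo (Q_fps - 1)"

definition w_fps :: "rat fps" where
  "w_fps = Q_fps ^ 3 * inverse R_fps ^ 2"

definition theta :: "rat fps \<Rightarrow> rat fps" where
  "theta g = Q_fps * inverse R_fps * qd g"

lemma inverse_R: "R_fps * inverse R_fps = 1"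
  by (rule inverse_mult_eq_1') simp

lemma t_fps_mult: "1728 * t_fps * Q_fps ^ 3 = Q_fps ^ 3 - R_fps ^ 2"
proof -
  have "inverse (Q_fps ^ 3) * Q_fps ^ 3 = 1"
    by (rule inverse_mult_eq_1) simp
  then have "1728 * t_fps * Q_fps ^ 3 = 1728 * fps_const (1 / 1728) * (Q_fps ^ 3 - R_fps ^ 2)"
    unfolding t_fps_def by algebra
  also have "1728 * fps_const (1 / 1728) = (1 :: rat fps)"
    by (simp add: numeral_fps_const)
  finally show ?thesis by simp
qed

lemma t_fps_nth_0 [simp]: "t_fps $ 0 = 0"
  by (simp add: t_fps_def fps_power_zeroth)

lemma t_fps_nth_1 [simp]: "t_fps $ Suc 0 = 1"
proof -
  have "{d. d dvd Suc 0} = {1}" by auto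
  then have "Q_fps $ Suc 0 = 240" "R_fps $ Suc 0 = - 504"
    by (simp_all add: Q_fps_def R_fps_def fps_numeral_mult_nth sigma_fps_nth)
  then show ?thesis
    by (simp add: t_fps_def fps_mult_nth_1' power_numeral_reduce)
qed

lemma sqrt_E4_nth_0 [simp]: "sqrt_E4 $ 0 = 1"
  by (simp add: sqrt_E4_def)

lemma sqrt_E4_square: "sqrt_E4 * sqrt_E4 = Q_fps"
proof -
  have "sqrt_E4 * sqrt_E4 = (fps_binomial (1 / 2) * fps_binomial (1 / 2)) oo (Q_fps - 1)"
    by (simp add: sqrt_E4_def fps_compose_mult_distrib)
  also have "fps_binomial (1 / 2) * fps_binomial (1 / 2) = (1 + fps_X :: rat fps)"
    by (simp flip: fps_binomial_add_mult add: fps_binomial_1)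
  finally show ?thesis
    by (simp add: fps_compose_add_distrib)
qed

lemma w_fps_t: "(1 - 1728 * t_fps) * w_fps = 1"
proof -
  have "(1 - 1728 * t_fps) * w_fps = (Q_fps ^ 3 - 1728 * t_fps * Q_fps ^ 3) * inverse R_fps ^ 2"
    by (simp add: w_fps_def algebra_simps)
  also have "\<dots> = (R_fps * inverse R_fps) ^ 2"
    by (simp add: t_fps_mult power_mult_distrib)
  finally show ?thesis by (simp add: inverse_R)
qed

lemma theta_simps:
  "theta (f + g) = theta f + theta g" "theta (f - g) = theta f - theta g"
  "theta (f * g) = theta f * g + f * theta g"
  "theta (numeral k) = 0" "theta 1 = 0"
  by (simp_all add: theta_def qd_simps algebra_simps)

text \<open>Differentiating \<open>t_fps_mult\<close> gives this: the derivatives of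
  \<open>Q_fps ^ 3\<close> and \<open>R_fps ^ 2\<close> share the term - R Q^2, so their difference
  is P (Q^3 - R^2), and the terms with P cancel.\<close>

lemma qd_t: "qd t_fps * Q_fps = t_fps * R_fps"
proof -
  have "qd (1728 * t_fps * Q_fps ^ 3) = qd (Q_fps ^ 3 - R_fps ^ 2)"
    by (simp only: t_fps_mult)
  then have "1728 * (qd t_fps * Q_fps ^ 3 + t_fps * (3 * qd Q_fps) * Q_fps ^ 2) =
     (3 * qd Q_fps) * Q_fps ^ 2 - R_fps * (2 * qd R_fps)"
    by (simp add: qd_simps power_numeral_reduce algebra_simps)
  then have "1728 * (qd t_fps * Q_fps ^ 3) + P_fps * (1728 * t_fps * Q_fps ^ 3) - 1728 * t_fps * R_fps * Q_fps ^ 2 =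
     P_fps * (Q_fps ^ 3 - R_fps ^ 2)"
    unfolding ramanujan by (simp add: power_numeral_reduce algebra_simps)
  then have "1728 * Q_fps ^ 2 * (qd t_fps * Q_fps) = 1728 * Q_fps ^ 2 * (t_fps * R_fps)"
    unfolding t_fps_mult by (simp add: power_numeral_reduce algebra_simps)
  moreover have "Q_fps \<noteq> 0"
    using PQR_nth_0(2) by fastforce
  ultimately show ?thesis by simp
qed

lemma theta_t: "theta t_fps = t_fps"
  using qd_t inverse_R unfolding theta_def by algebra

text \<open>By the chain rule and \<open>theta_t\<close>, \<open>theta\<close> acts on series in
  \<open>t_fps\<close> as \<open>qd\<close> acts on series in X.\<close>

lemma theta_compose: "theta (g oo t_fps) = qd g oo t_fps"
proof -
  have "theta (g oo t_fps) = (fps_deriv g oo t_fps) * theta t_fps"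
    by (simp add: theta_def qd_def fps_compose_deriv algebra_simps)
  also have "\<dots> = qd g oo t_fps"
    by (simp add: theta_t qd_def fps_compose_mult_distrib mult.commute)
  finally show ?thesis .
qed

text \<open>This is the hypergeometric equation of \<open>S_fps_ode\<close>, transported to t and
  solved for the leading term: multiply by 72 w and use w - 1 = 1728 t w.\<close>

lemma sqrt_E4_ode:
  "72 * theta (theta (theta sqrt_E4)) =
    (w_fps - 1) * (108 * theta (theta sqrt_E4) + 46 * theta sqrt_E4 + 5 * sqrt_E4)"
proof -
  let ?V = "inverse R_fps" and ?f = sqrt_E4 and ?w = w_fps
  txt \<open>\<open>theta\<close> preserves the weight-0 ring generated by \<open>z\<close> and \<open>w\<close>, so each \<open>theta\<close>-derivative of
    \<open>sqrt_E4\<close> is \<open>sqrt_E4\<close> times a polynomial in \<open>z\<close> and \<open>w\<close>.\<close>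
  define z where "z = P_fps * Q_fps * ?V"
  have nz: "sqrt_E4 \<noteq> 0" 
    using sqrt_E4_nth_0 by fastforce
  have V: "2 * qd ?V = - (?V ^ 2 * (P_fps * R_fps - Q_fps ^ 2))"
  proof -
    have "qd (R_fps * ?V) = 0" by (simp add: inverse_R qd_simps)
    then have "qd R_fps * ?V + R_fps * qd ?V = 0" by (simp add: qd_simps)
    with inverse_R have "2 * qd ?V = - (?V ^ 2 * (2 * qd R_fps))" by algebra
    then show ?thesis by (simp add: ramanujan)
  qed
  have f: "6 * theta ?f = ?f * (z - 1)"
  proof -
    have "qd (?f * ?f) = qd Q_fps" by (simp add: sqrt_E4_square)
    then have "2 * ?f * qd ?f = qd Q_fps" by (simp add: qd_simps algebra_simps)
    then have "3 * (2 * ?f * qd ?f) = P_fps * Q_fps - R_fps" by (simp only: ramanujan)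
    then have "6 * ?f * qd ?f = P_fps * Q_fps - R_fps" by (simp add: algebra_simps)
    then have "?f * (6 * theta ?f) = ?f * (?f * (z - 1))"
      unfolding theta_def z_def using inverse_R sqrt_E4_square by algebra
    then show ?thesis using nz by simp
  qed
  have z: "12 * theta z = - (z * z) - 4 * z + 6 * z * ?w - ?w"
  proof -
    have "12 * theta z = Q_fps * ?V * (12 * qd P_fps * Q_fps * ?V + 4 * P_fps * (3 * qd Q_fps) * ?V
        + 6 * P_fps * Q_fps * (2 * qd ?V))"
      by (simp add: theta_def z_def qd_simps algebra_simps)
    also have "\<dots> = - (z * z) - 4 * z + 6 * z * ?w - ?w"
      unfolding ramanujan V unfolding z_def w_fps_def using inverse_R by algebra
    finally show ?thesis .
  qed
  have w: "theta ?w = ?w * (?w - 1)"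
  proof -
    have "theta ?w = Q_fps * ?V * ((3 * qd Q_fps) * Q_fps ^ 2 * ?V ^ 2 + Q_fps ^ 3 * ?V * (2 * qd ?V))"
      by (simp add: theta_def w_fps_def qd_simps power_numeral_reduce algebra_simps)
    also have "\<dots> = ?w * (?w - 1)"
      unfolding ramanujan V unfolding w_fps_def using inverse_R by algebra
    finally show ?thesis .
  qed
  \<comment> \<open>The cofactor in 72 theta (theta f) = f (2 (z - 1)^2 + 12 theta z), after
    inserting the formula for \<open>theta z\<close>.\<close>
  define u where "u = z * z - 8 * z + 2 + 6 * z * ?w - ?w"
  have f2: "72 * theta (theta ?f) = ?f * u"
  proof -
    have "theta (6 * theta ?f) = theta (?f * (z - 1))" by (simp add: f)
    then have "6 * theta (theta ?f) = theta ?f * (z - 1) + ?f * theta z"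
      by (simp add: theta_simps)
    with f z show ?thesis unfolding u_def by algebra
  qed
  have "theta (72 * theta (theta ?f)) = theta (?f * u)" by (simp add: f2)
  then have f3: "72 * theta (theta (theta ?f)) = theta ?f * u + ?f * theta u"
    by (simp add: theta_simps)
  have u: "theta u = 2 * z * theta z - 8 * theta z + 6 * theta z * ?w + 6 * z * theta ?w - theta ?w"
    by (simp add: u_def theta_simps algebra_simps)
  have "12 * (72 * theta (theta (theta ?f))) =
      2 * (6 * theta ?f) * u + ?f * ((2 * z - 8 + 6 * ?w) * (12 * theta z) + 12 * (6 * z - 1) * theta ?w)"
    unfolding f3 u by (simp add: algebra_simps)
  \<comment> \<open>The numbers 18, 92 and 60 are 12 times 108/72, 46/6 and 5, matching the
    normalizations in \<open>f2\<close> and \<open>f\<close>.\<close>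
  also have "\<dots> = (?w - 1) * (18 * (?f * u) + 92 * (?f * (z - 1)) + 60 * ?f)"
    unfolding f z w u_def by (simp add: algebra_simps)
  also have "\<dots> = 12 * ((?w - 1) * (108 * theta (theta ?f) + 46 * theta ?f + 5 * ?f))"
    unfolding f2[symmetric] f[symmetric] by (simp add: algebra_simps)
  finally show ?thesis
    by (subst (asm) mult_cancel_left) simp
qed

section \<open>The hypergeometric series and its identification with the root of E4\<close>

definition A_coeff :: "nat \<Rightarrow> rat" where
  "A_coeff m = fact (6 * m) / (fact m ^ 3 * fact (3 * m))"

lemma A_coeff_Suc:
  "of_nat (Suc m) ^ 3 * A_coeff (Suc m) =
    24 * (6 * of_nat m + 1) * (2 * of_nat m + 1) * (6 * of_nat m + 5) * A_coeff m"
proof -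
  have 6: "fact (6 * Suc m) = ((6 * of_nat m + 1) * (6 * of_nat m + 2) * (6 * of_nat m + 3) *
      (6 * of_nat m + 4) * (6 * of_nat m + 5) * (6 * of_nat m + 6) * fact (6 * m) :: rat)"
    by (simp add: fact_reduce numeral_eq_Suc algebra_simps)
  have 3: "fact (3 * Suc m) =
    ((3 * of_nat m + 1) * (3 * of_nat m + 2) * (3 * of_nat m + 3) * fact (3 * m) :: rat)"
    by (simp add: numeral_eq_Suc algebra_simps)
  have 1: "fact (Suc m) = ((of_nat m + 1) * fact m :: rat)"
    by (simp add: algebra_simps)
  have nz: "(of_nat m + 1 :: rat) \<noteq> 0" "(3 * of_nat m + 1 :: rat) \<noteq> 0"
    "(3 * of_nat m + 2 :: rat) \<noteq> 0" "(3 * of_nat m + 3 :: rat) \<noteq> 0"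
    using of_nat_neq_0[of m, where 'a = rat] of_nat_neq_0[of "3 * m", where 'a = rat]
      of_nat_neq_0[of "3 * m + 1", where 'a = rat] of_nat_neq_0[of "3 * m + 2", where 'a = rat]
    by (simp_all add: add.commute)
  show ?thesis
    unfolding A_coeff_def 6 3 1 of_nat_Suc using nz
    by (simp add: divide_simps power_mult_distrib add.commute) (simp add: algebra_simps power_numeral_reduce)
qed

definition S_fps :: "rat fps" where
  "S_fps = Abs_fps A_coeff"

text \<open>Comparing coefficients gives the recursion \<open>A_coeff_Suc\<close>, because (6m +
  1)(2m + 1)(6m + 5) = 72 m^3 + 108 m^2 + 46 m + 5.\<close>

lemma S_fps_ode:
  "qd (qd (qd S_fps)) = 24 * fps_X * (72 * qd (qd (qd S_fps)) + 108 * qd (qd S_fps) + 46 * qd S_fps + 5 * S_fps)"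
  (is "?l = ?r")
proof (rule fps_ext)
  fix n
  show "?l $ n = ?r $ n"
  proof (cases n)
    case 0
    then show ?thesis by simp
  next
    case (Suc m)
    have "?r $ n = 24 * (72 * of_nat m ^ 3 + 108 * of_nat m ^ 2 + 46 * of_nat m + 5) * A_coeff m"
      by (simp add: mult.assoc fps_numeral_mult_nth Suc S_fps_def algebra_simps power_numeral_reduce)
    also have "\<dots> = of_nat (Suc m) ^ 3 * A_coeff (Suc m)"
      unfolding A_coeff_Suc by (simp add: algebra_simps power_numeral_reduce)
    also have "\<dots> = ?l $ n"
      unfolding Suc by (simp add: S_fps_def algebra_simps power_numeral_reduce)
    finally show ?thesis ..
  qed
qed

text \<open>\<open>theta\<close> multiplies a leading coefficient at q^n by n, as Q/R has constant
  term 1, and \<open>w_fps - 1\<close> has constant term 0. If all coefficients below n > 0 vanish,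
  the equation at q^n therefore reads 72 n^3 \<open>e $ n\<close> = 0.\<close>

lemma theta_ode_unique:
  assumes "72 * theta (theta (theta e)) = (w_fps - 1) * (108 * theta (theta e) + 46 * theta e + 5 * e)"
    and "e $ 0 = 0"
  shows "e = 0"
proof (rule fps_ext)
  have lead: "(\<forall>i<n. theta g $ i = 0) \<and> theta g $ n = of_nat n * g $ n" if "\<forall>i<n. g $ i = 0" for g n
  proof -
    have "(a * qd g) $ i = a $ 0 * (of_nat i * g $ i)" if "i \<le> n" for i and a :: "rat fps"
    proof -
      have "(a * qd g) $ i = (\<Sum>j=0..i. a $ j * qd g $ (i - j))"
        by (simp only: fps_mult_nth)
      also have "\<dots> = (\<Sum>j\<in>{0}. a $ j * qd g $ (i - j))"
        using that \<open>\<forall>i<n. g $ i = 0\<close> by (intro sum.mono_neutral_right) auto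
      finally show ?thesis by simp
    qed
    from this[of _ "Q_fps * inverse R_fps"] that show ?thesis
      by (simp add: theta_def)
  qed
  fix n
  show "e $ n = 0 $ n"
  proof (induction n rule: less_induct)
    case (less n)
    show ?case
    proof (cases "n = 0")
      case False
      have 0: "\<forall>i<n. e $ i = 0" using less by auto
      note 1 = lead[OF 0]
      note 2 = lead[OF conjunct1[OF 1]]
      note 3 = lead[OF conjunct1[OF 2]]
      let ?g = "108 * theta (theta e) + 46 * theta e + 5 * e"
      have "((w_fps - 1) * ?g) $ n = (\<Sum>j=0..n. (w_fps - 1) $ j * ?g $ (n - j))"
        by (simp only: fps_mult_nth)
      also have "\<dots> = 0"
      proof (rule sum.neutral, rule ballI)
        fix j assume "j \<in> {0..n}"
        show "(w_fps - 1) $ j * ?g $ (n - j) = 0"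
          by (cases "j = 0") (use 0 1 2 False \<open>j \<in> _\<close> in \<open>auto simp: w_fps_def fps_numeral_mult_nth fps_power_zeroth\<close>)
      qed
      finally have "(72 * theta (theta (theta e))) $ n = 0"
        by (simp add: assms(1))
      then show ?thesis
        using 1 2 3 False by (simp add: fps_numeral_mult_nth)
    qed (simp add: assms)
  qed
qed

text \<open>Both sides solve the same linear equation and have constant term 1, so uniqueness
  applies to their difference.\<close>

lemma sqrt_E4_eq: "sqrt_E4 = S_fps oo t_fps"
proof -
  let ?G = "S_fps oo t_fps"
  have num: "(numeral k oo t_fps) = (numeral k :: rat fps)" for k
    by (simp add: numeral_fps_const)
  have "theta (theta (theta ?G)) = 24 * t_fps * (72 * theta (theta (theta ?G)) + 108 * theta (theta ?G) + 46 * theta ?G + 5 * ?G)"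
    unfolding theta_compose
    by (subst S_fps_ode) (simp add: fps_compose_mult_distrib fps_compose_add_distrib num)
  then have G: "72 * theta (theta (theta ?G)) =
      (w_fps - 1) * (108 * theta (theta ?G) + 46 * theta ?G + 5 * ?G)"
    using w_fps_t by algebra
  have "sqrt_E4 - ?G = 0"
  proof (rule theta_ode_unique)
    show "72 * theta (theta (theta (sqrt_E4 - ?G))) = (w_fps - 1) *
        (108 * theta (theta (sqrt_E4 - ?G)) + 46 * theta (sqrt_E4 - ?G) + 5 * (sqrt_E4 - ?G))"
      using sqrt_E4_ode G unfolding theta_simps by algebra
    show "(sqrt_E4 - ?G) $ 0 = 0"
      by (simp add: S_fps_def A_coeff_def)
  qed
  then show ?thesis by simp
qed

section \<open>The quotient as a differential\<close>

text \<open>\<open>(1 - 1728 X)\<close> to the power \<open>-1/2\<close>.\<close>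

definition W_fps :: "rat fps" where
  "W_fps = fps_binomial (- 1 / 2) oo (fps_const (- 1728) * fps_X)"

lemma W_fps_nth: "W_fps $ n = (- 1728) ^ n * ((- 1 / 2) gchoose n)"
  by (simp add: W_fps_def fps_compose_linear)

lemma W_fps_square: "W_fps * W_fps * (1 - 1728 * fps_X) = 1"
proof -
  let ?b = "fps_const (- 1728) * fps_X :: rat fps"
  have "W_fps * W_fps * (1 - 1728 * fps_X) =
      (fps_binomial (- 1 / 2) * fps_binomial (- 1 / 2) * (1 + fps_X)) oo ?b"
    by (simp add: W_fps_def fps_compose_mult_distrib fps_compose_add_distrib numeral_fps_const
        flip: fps_const_neg)
  also have "fps_binomial (- 1 / 2) * fps_binomial (- 1 / 2) * (1 + fps_X) = (1 :: rat fps)"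
    by (simp flip: fps_binomial_add_mult
        add: fps_binomial_minus_one inverse_mult_eq_1)
  finally show ?thesis by simp
qed

text \<open>Both squares equal Q^3, and the constant terms fix the sign.\<close>

lemma W_fps_compose: "R_fps * (W_fps oo t_fps) = sqrt_E4 ^ 3"
proof -
  let ?W = "W_fps oo t_fps"
  have "(W_fps * W_fps * (1 - 1728 * fps_X)) oo t_fps = 1"
    by (simp add: W_fps_square)
  then have "?W * ?W * (1 - 1728 * t_fps) = 1"
    by (simp add: fps_compose_mult_distrib fps_compose_sub_distrib numeral_fps_const)
  then have "(R_fps * ?W) ^ 2 = (sqrt_E4 ^ 3) ^ 2"
    using w_fps_t inverse_R sqrt_E4_square unfolding w_fps_def by algebra
  then consider "R_fps * ?W = sqrt_E4 ^ 3" | "R_fps * ?W = - (sqrt_E4 ^ 3)"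
    using power2_eq_iff by blast
  then show ?thesis
  proof cases
    case 2
    then have "(R_fps * ?W) $ 0 = (- (sqrt_E4 ^ 3)) $ 0" by simp
    then show ?thesis by (simp add: fps_power_zeroth W_fps_nth)
  qed
qed

definition G_fps :: "rat \<Rightarrow> rat fps" where
  "G_fps c = Abs_fps (\<lambda>n. c ^ n)"

lemma G_fps_mult: "(1 - fps_const c * fps_X) * G_fps c = 1"
proof (rule fps_ext)
  fix n
  show "((1 - fps_const c * fps_X) * G_fps c) $ n = 1 $ n"
    by (cases n) (simp_all add: G_fps_def algebra_simps mult.assoc)
qed

text \<open>From Delta = t Q^3 one gets j = 1/t, so the quotient is Q t / (1 - c t), with
  \<open>G_fps\<close> supplying the geometric series.\<close>

lemma E4_quotient_eq:
  "E4 / (j_invariant - fls_const c) = fps_to_fls (Q_fps * t_fps * (G_fps c oo t_fps))"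
proof -
  let ?Q = "fps_to_fls Q_fps" and ?R = "fps_to_fls R_fps" and ?t = "fps_to_fls t_fps"
    and ?G = "fps_to_fls (G_fps c oo t_fps)"
  have Q: "E4 = ?Q"
    unfolding E4_def by (rule arg_cong[of _ _ fps_to_fls], rule fps_ext)
      (simp add: Q_fps_def fps_numeral_mult_nth sigma_fps_def divisor_power_sum_def)
  have R: "E6 = ?R"
    unfolding E6_def by (rule arg_cong[of _ _ fps_to_fls], rule fps_ext)
      (simp add: R_fps_def fps_numeral_mult_nth sigma_fps_def divisor_power_sum_def)
  have "fps_to_fls (1728 * t_fps * Q_fps ^ 3) = fps_to_fls (Q_fps ^ 3 - R_fps ^ 2)"
    by (simp only: t_fps_mult)
  then have "?Q ^ 3 - ?R ^ 2 = 1728 * (?t * ?Q ^ 3)"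
    by (simp add: fls_times_fps_to_fls fps_to_fls_power mult.assoc)
  then have D: "modular_discriminant = ?t * ?Q ^ 3"
    by (simp add: modular_discriminant_def Q R)
  have "((1 - fps_const c * fps_X) * G_fps c) oo t_fps = 1"
    by (simp add: G_fps_mult)
  then have "(1 - fps_const c * t_fps) * (G_fps c oo t_fps) = 1"
    by (simp add: fps_compose_mult_distrib fps_compose_sub_distrib)
  then have "fps_to_fls ((1 - fps_const c * t_fps) * (G_fps c oo t_fps)) = 1"
    by simp
  then have G: "(1 - fls_const c * ?t) * ?G = 1"
    by (simp add: fls_times_fps_to_fls)
  have "Q_fps \<noteq> 0" "t_fps \<noteq> 0"
    using PQR_nth_0(2) t_fps_nth_1 by fastforce+
  then have nz: "?Q \<noteq> 0" "?t \<noteq> 0" by simp_all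
  have nz': "1 - fls_const c * ?t \<noteq> 0" using G by auto
  have "j_invariant - fls_const c = (1 - fls_const c * ?t) / ?t"
    using nz by (simp add: j_invariant_def Q D field_simps)
  then have "E4 / (j_invariant - fls_const c) = ?Q * ?t / (1 - fls_const c * ?t)"
    using nz by (simp add: Q)
  also have "\<dots> = ?Q * ?t * ?G"
    by (subst nonzero_divide_eq_eq[OF nz']) (use G in algebra)
  finally show ?thesis by (simp add: fls_times_fps_to_fls)
qed

text \<open>With S(t) = Q^(1/2), W(t) = Q^(3/2) / R and D t = t R / Q, the product S(t) W(t) D t is
  Q t.\<close>

lemma E4_quotient_differential:
  "Q_fps * t_fps * (G_fps c oo t_fps) = ((S_fps * (W_fps * G_fps c)) oo t_fps) * qd t_fps"
proof -
  have "Q_fps * (((S_fps * (W_fps * G_fps c)) oo t_fps) * qd t_fps) =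
      Q_fps * (Q_fps * t_fps * (G_fps c oo t_fps))"
    using qd_t W_fps_compose sqrt_E4_square
    by (simp add: fps_compose_mult_distrib flip: sqrt_E4_eq) algebra
  moreover have "Q_fps \<noteq> 0"
    using PQR_nth_0(2) by fastforce
  ultimately show ?thesis by simp
qed

text \<open>The \<open>n\<close>-th coefficient of a derivative \<open>q d/dq\<close> is divisible by \<open>n\<close>, so only the term \<open>i = n\<close>
  of the integrated expansion survives modulo a prime \<open>n\<close>.\<close>

lemma E4_quotient_nth:
  fixes c :: rat and n :: nat
  defines "U \<equiv> S_fps * (W_fps * G_fps c)"
  assumes n: "n > 0"
  shows "fls_nth (E4 / (j_invariant - fls_const c)) (int n) =
    U $ (n - 1) + of_nat n * (\<Sum>i\<in>{1..<n}. U $ (i - 1) / of_nat i * (t_fps ^ i) $ n)"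
proof -
  let ?I = "fps_integral0 U"
  have I: "?I $ i = U $ (i - 1) / of_nat i" if "i > 0" for i
    using that by (cases i) (simp_all add: field_simps)
  have "(U oo t_fps) * qd t_fps = qd (?I oo t_fps)"
    by (simp add: qd_def fps_compose_deriv fps_deriv_fps_integral algebra_simps)
  then have "fls_nth (E4 / (j_invariant - fls_const c)) (int n) = of_nat n * (?I oo t_fps) $ n"
    unfolding E4_quotient_eq E4_quotient_differential U_def by simp
  also have "(?I oo t_fps) $ n = (\<Sum>i=0..n. ?I $ i * (t_fps ^ i) $ n)"
    by (rule fps_compose_nth)
  \<comment> \<open>The term i = 0 drops out because \<open>fps_integral0\<close> has constant term
    0.\<close>
  also have "\<dots> = (\<Sum>i\<in>insert n {1..<n}. ?I $ i * (t_fps ^ i) $ n)"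
    by (rule sum.mono_neutral_right) (auto simp: not_less_eq_eq)
  \<comment> \<open>As \<open>t_fps\<close> begins with q, the coefficient of q^n in
    \<open>t_fps ^ n\<close> is 1.\<close>
  also have "\<dots> = U $ (n - 1) / of_nat n + (\<Sum>i\<in>{1..<n}. U $ (i - 1) / of_nat i * (t_fps ^ i) $ n)"
    using n by (simp add: I startsby_zero_power_nth_same)
  finally show ?thesis using n by (simp add: distrib_left)
qed

section \<open>Congruences modulo p\<close>

text \<open>The localization of the integers at p. Fractions need not be in lowest terms, which
  makes closure under sums and products immediate.\<close>

definition p_integral :: "nat \<Rightarrow> rat \<Rightarrow> bool" where
  "p_integral p x \<longleftrightarrow> (\<exists>a b. \<not> int p dvd b \<and> x = of_int a / of_int b)"

lemma p_integral_of_int [intro, simp]: "prime p \<Longrightarrow> p_integral p (of_int k)"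
  unfolding p_integral_def by (rule exI[of _ k], rule exI[of _ 1]) (auto simp: prime_nat_iff)

lemma p_integral_mult [intro]:
  assumes "prime p" "p_integral p x" "p_integral p y" shows "p_integral p (x * y)"
proof -
  obtain a b a' b' where *: "\<not> int p dvd b" "x = of_int a / of_int b"
    "\<not> int p dvd b'" "y = of_int a' / of_int b'"
    using assms unfolding p_integral_def by metis
  then have "x * y = of_int (a * a') / of_int (b * b')" by simp
  moreover have "\<not> int p dvd b * b'" using * assms(1) by (simp add: prime_dvd_mult_iff)
  ultimately show ?thesis unfolding p_integral_def by blast
qed

lemma p_integral_add [intro]:
  assumes "prime p" "p_integral p x" "p_integral p y" shows "p_integral p (x + y)"
proof -
  obtain a b a' b' where *: "\<not> int p dvd b" "x = of_int a / of_int b"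
    "\<not> int p dvd b'" "y = of_int a' / of_int b'"
    using assms unfolding p_integral_def by metis
  then have "b \<noteq> 0" "b' \<noteq> 0" by auto
  with * have "x + y = of_int (a * b' + a' * b) / of_int (b * b')"
    by (simp add: field_simps)
  moreover have "\<not> int p dvd b * b'" using * assms(1) by (simp add: prime_dvd_mult_iff)
  ultimately show ?thesis unfolding p_integral_def by blast
qed

lemma p_integral_numeral [intro, simp]:
  assumes "prime p"
  shows "p_integral p 0" "p_integral p 1" "p_integral p (numeral k)" "p_integral p (of_nat m)"
  using p_integral_of_int[OF assms, of 0] p_integral_of_int[OF assms, of 1]
    p_integral_of_int[OF assms, of "numeral k"] p_integral_of_int[OF assms, of "int m"] by simp_all

lemma p_integral_minus [intro]:
  assumes "prime p" "p_integral p x" shows "p_integral p (- x)"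
  using p_integral_mult[OF assms(1) p_integral_of_int[OF assms(1), of "-1"] assms(2)] by simp

lemma p_integral_diff [intro]:
  assumes "prime p" "p_integral p x" "p_integral p y" shows "p_integral p (x - y)"
  using p_integral_add[OF assms(1,2) p_integral_minus[OF assms(1,3)]] by simp

lemma p_integral_power [intro]:
  assumes "prime p" "p_integral p x" shows "p_integral p (x ^ n)"
  by (induction n) (use assms in auto)

lemma p_integral_sum [intro]:
  assumes "prime p" "\<And>i. i \<in> I \<Longrightarrow> p_integral p (f i)" shows "p_integral p (sum f I)"
  using assms(2) by (induction I rule: infinite_finite_induct) (use assms(1) in auto)

lemma p_integral_divide [intro]:
  assumes "prime p" "p_integral p x" "\<not> p dvd m" shows "p_integral p (x / of_nat m)"
proof -
  have "p_integral p (1 / of_nat m)"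
    unfolding p_integral_def using assms(3)
    by (intro exI[of _ 1] exI[of _ "int m"]) simp
  from p_integral_mult[OF assms(1,2) this] show ?thesis by simp
qed

definition p_cong :: "nat \<Rightarrow> rat \<Rightarrow> rat \<Rightarrow> bool" where
  "p_cong p x y \<longleftrightarrow> p_integral p ((x - y) / of_nat p)"

lemma p_cong_refl [simp, intro]: "prime p \<Longrightarrow> p_cong p x x"
  by (simp add: p_cong_def)

lemma p_cong_sym: "prime p \<Longrightarrow> p_cong p x y \<Longrightarrow> p_cong p y x"
  unfolding p_cong_def by (drule (1) p_integral_minus) (simp add: diff_divide_distrib)

lemma p_cong_add [intro]:
  assumes "prime p" "p_cong p x y" "p_cong p x' y'" shows "p_cong p (x + x') (y + y')"
  using p_integral_add[OF assms(1) assms(2,3)[unfolded p_cong_def]]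
  by (simp add: p_cong_def add_divide_distrib diff_divide_distrib algebra_simps)

lemma p_cong_trans:
  assumes "prime p" "p_cong p x y" "p_cong p y z" shows "p_cong p x z"
  using p_integral_add[OF assms(1) assms(2,3)[unfolded p_cong_def]]
  by (simp add: p_cong_def diff_divide_distrib)

lemma p_cong_sum [intro]:
  assumes "prime p" "\<And>i. i \<in> I \<Longrightarrow> p_cong p (f i) (g i)" shows "p_cong p (sum f I) (sum g I)"
  using assms(2) by (induction I rule: infinite_finite_induct) (use assms(1) in auto)

lemma p_cong_mult_right:
  assumes "prime p" "p_cong p x y" "p_integral p z" shows "p_cong p (x * z) (y * z)"
  using p_integral_mult[OF assms(1) assms(2,3)[unfolded p_cong_def]]
  by (simp add: p_cong_def left_diff_distrib)

lemma p_cong_mult_left: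
  assumes "prime p" "p_cong p x y" "p_integral p z" shows "p_cong p (z * x) (z * y)"
  using p_cong_mult_right[OF assms] by (simp add: mult.commute)

lemma p_cong_divide:
  assumes "prime p" "p_cong p x y" "\<not> p dvd m" shows "p_cong p (x / of_nat m) (y / of_nat m)"
  using p_integral_divide[OF assms(1) assms(2)[unfolded p_cong_def] assms(3)]
  by (simp add: p_cong_def diff_divide_distrib mult.commute)

lemma p_cong_mult_0: 
  assumes "prime p" "p_integral p x" shows "p_cong p (of_nat p * x) 0"
  using assms prime_gt_0_nat[OF assms(1)] by (simp add: p_cong_def)

text \<open>Let u/v be the difference in lowest terms. Clearing denominators shows that p divides u,
  hence not v, so the valuation is at least 1.\<close>

lemma p_cong_imp_rat_cong:
  assumes p: "prime p" and "p_cong p x y"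
  shows "rat_cong p x y"
proof (cases "x = y")
  case False
  obtain a b where ab: "\<not> int p dvd b" "(x - y) / of_nat p = of_int a / of_int b"
    using assms(2) unfolding p_cong_def p_integral_def by blast
  define u v where "u = fst (quotient_of (x - y))" and "v = snd (quotient_of (x - y))"
  have q: "quotient_of (x - y) = (u, v)" by (simp add: u_def v_def)
  have v: "v > 0" and cop: "coprime u v" and xy: "x - y = of_int u / of_int v"
    using quotient_of_denom_pos[OF q] quotient_of_coprime[OF q] quotient_of_div[OF q] by auto
  have "b \<noteq> 0" using ab by auto
  have "of_int u * of_int b = (of_nat p * of_int a * of_int v :: rat)"
    using ab(2) v \<open>b \<noteq> 0\<close> prime_gt_0_nat[OF p] unfolding xy by (simp add: field_simps)
  then have "of_int (u * b) = (of_int (int p * (a * v)) :: rat)" by simp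
  then have ub: "u * b = int p * (a * v)" by (simp only: of_int_eq_iff)
  then have pu: "int p dvd u"
    using ab(1) p by (metis dvd_triv_left prime_dvd_mult_iff prime_nat_int_transfer)
  then have "\<not> int p dvd v"
    using cop p by (metis coprime_common_divisor not_prime_unit prime_nat_int_transfer)
  then have "multiplicity (int p) v = 0" by (rule not_dvd_imp_multiplicity_0)
  moreover have "u \<noteq> 0" using xy False by auto
  then have "multiplicity (int p) u > 0"
    using pu p by (subst prime_multiplicity_gt_zero_iff) auto
  ultimately show ?thesis
    unfolding rat_cong_def padic_val_def u_def v_def by simp
qed (simp add: rat_cong_def)

text \<open>In lowest terms p cannot divide both numerator and denominator, so equal multiplicities
  mean that it divides neither.\<close>

lemma p_integral_if_padic_val_0:
  assumes p: "prime p" and "c \<noteq> 0" "padic_val p c = 0"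
  shows "p_integral p c" and "p_integral p (inverse c)"
proof -
  define u v where "u = fst (quotient_of c)" and "v = snd (quotient_of c)"
  have q: "quotient_of c = (u, v)" by (simp add: u_def v_def)
  have v: "v > 0" and cop: "coprime u v" and c: "c = of_int u / of_int v"
    using quotient_of_denom_pos[OF q] quotient_of_coprime[OF q] quotient_of_div[OF q] by auto
  have nz: "u \<noteq> 0" "v \<noteq> 0" using assms c v by auto
  have eq: "multiplicity (int p) u = multiplicity (int p) v"
    using assms(3) by (simp add: padic_val_def u_def v_def)
  have pp: "prime (int p)" using p by simp
  have "int p dvd u \<longleftrightarrow> int p dvd v"
    using prime_multiplicity_gt_zero_iff[of "int p" u] prime_multiplicity_gt_zero_iff[of "int p" v] nz eq pp
    by (metis prime_elem_multiplicity_eq_zero_iff prime_imp_prime_elem)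
  then have "\<not> int p dvd u" "\<not> int p dvd v"
    using cop pp by (metis coprime_common_divisor not_prime_unit)+
  then show "p_integral p c" "p_integral p (inverse c)"
    unfolding p_integral_def c by auto
qed

section \<open>Integrality of power series coefficients\<close>

lemma p_integral_fps_mult_nth:
  assumes "prime p" "\<And>i. i \<le> n \<Longrightarrow> p_integral p (A $ i)" "\<And>i. i \<le> n \<Longrightarrow> p_integral p (B $ i)"
  shows "p_integral p ((A * B) $ n)"
  unfolding fps_mult_nth using assms by (intro p_integral_sum p_integral_mult) auto

lemma p_integral_fps_power_nth:
  assumes "prime p" "\<And>n. p_integral p (A $ n)"
  shows "p_integral p ((A ^ k) $ n)"
  by (induction k arbitrary: n) (use assms in \<open>auto intro: p_integral_fps_mult_nth\<close>)

text \<open>Since B has constant term 1, the coefficients of A are found recursively without any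
  division.\<close>

lemma p_integral_fps_divide:
  assumes p: "prime p" and "\<And>n. p_integral p ((A * B) $ n)" "\<And>n. p_integral p (B $ n)" "B $ 0 = 1"
  shows "p_integral p (A $ n)"
proof (induction n rule: less_induct)
  case (less n)
  have "(A * B) $ n = (\<Sum>i=0..n. A $ i * B $ (n - i))" by (simp add: fps_mult_nth)
  also have "\<dots> = A $ n + (\<Sum>i\<in>{0..<n}. A $ i * B $ (n - i))"
    by (simp add: assms(4) atLeast0AtMost lessThan_Suc_atMost[symmetric] atLeast0LessThan)
  finally have "A $ n = (A * B) $ n - (\<Sum>i\<in>{0..<n}. A $ i * B $ (n - i))" by simp
  then show ?case using assms less
    by (metis (no_types, lifting) atLeastLessThan_iff p_integral_diff p_integral_mult p_integral_sum)
qed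

lemma p_integral_t_fps:
  assumes p: "prime p" and "p \<ge> 5"
  shows "p_integral p (t_fps $ n)"
proof (rule p_integral_fps_divide[OF p])
  have sig: "p_integral p (sigma_fps k $ n)" for k n
    using p by (simp add: sigma_fps_def)
  have Q: "p_integral p (Q_fps $ n)" for n
    using p sig by (auto simp: Q_fps_def fps_numeral_mult_nth)
  have R: "p_integral p (R_fps $ n)" for n
    using p sig by (auto simp: R_fps_def fps_numeral_mult_nth)
  show "p_integral p ((Q_fps ^ 3) $ n)" for n
    by (rule p_integral_fps_power_nth[OF p Q])
  show "(Q_fps ^ 3) $ 0 = 1" by (simp add: fps_power_zeroth)
  have "\<not> p dvd 2" "\<not> p dvd 3" using assms(2) by (auto dest: dvd_imp_le)
  \<comment> \<open>This is the factorization of 1728, the only denominator in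
    \<open>t_fps\<close>.\<close>
  then have "\<not> p dvd 2 ^ 6 * 3 ^ 3"
    using p by (metis prime_dvd_mult_iff prime_dvd_power)
  then have np: "\<not> p dvd 1728" by simp
  show "p_integral p ((t_fps * Q_fps ^ 3) $ n)" for n
  proof -
    have "1728 * (t_fps * Q_fps ^ 3) $ n = (Q_fps ^ 3 - R_fps ^ 2) $ n"
      unfolding t_fps_mult[symmetric] by (simp add: mult.assoc fps_numeral_mult_nth)
    then have "(t_fps * Q_fps ^ 3) $ n = (Q_fps ^ 3 - R_fps ^ 2) $ n / of_nat 1728"
      by simp
    moreover have "p_integral p ((Q_fps ^ 3 - R_fps ^ 2) $ n)"
      using p_integral_fps_power_nth[OF p Q] p_integral_fps_power_nth[OF p R] p by auto
    ultimately show ?thesis using p_integral_divide[OF p _ np] by metis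
  qed
qed

section \<open>The coefficients of S, W and G modulo p\<close>

text \<open>The recursion divides only by cubes of numbers below p. At the step where 6m first
  reaches p, a factor of the numerator is p itself, and the vanishing then persists.\<close>

lemma A_coeff_mod_p:
  assumes p: "prime p" "p \<ge> 5" and "m < p"
  shows "p_integral p (A_coeff m) \<and> (p \<le> 6 * m \<longrightarrow> p_cong p (A_coeff m) 0)"
  using \<open>m < p\<close>
proof (induction m)
  case 0
  then show ?case using p by (simp add: A_coeff_def)
next
  case (Suc m)
  let ?k = "24 * (6 * m + 1) * (2 * m + 1) * (6 * m + 5)"
  have IH: "p_integral p (A_coeff m)" "p \<le> 6 * m \<Longrightarrow> p_cong p (A_coeff m) 0"
    using Suc by auto
  have "\<not> p dvd Suc m" using Suc.prems by (auto dest: dvd_imp_le)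
  then have np: "\<not> p dvd Suc m ^ 3" using p prime_dvd_power by blast
  have eq: "A_coeff (Suc m) = of_nat ?k * A_coeff m / of_nat (Suc m ^ 3)"
    using A_coeff_Suc[of m] of_nat_neq_0[of m, where 'a = rat]
    by (simp add: field_simps del: of_nat_Suc) 
  have int: "p_integral p (A_coeff (Suc m))"
    unfolding eq by (rule p_integral_divide[OF p(1) p_integral_mult[OF p(1) _ IH(1)] np])
      (rule p_integral_numeral[OF p(1)])
  moreover have "p_cong p (A_coeff (Suc m)) 0" if le: "p \<le> 6 * Suc m"
  proof -
    have "p_cong p (of_nat ?k * A_coeff m) 0"
    proof (cases "p \<le> 6 * m")
      case True
      show ?thesis
        using p_cong_mult_left[OF p(1) IH(2)[OF True] p_integral_numeral(4)[OF p(1)], of ?k]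
        by (simp only: mult_zero_right)
    next
      case False
      have nd: "\<not> 2 dvd p" "\<not> 3 dvd p"
        using p primes_dvd_imp_eq[of 2 p] primes_dvd_imp_eq[of 3 p] by auto
      \<comment> \<open>Here p lies between 6m + 1 and 6m + 6 and is prime to 6.\<close>
      have "p = 6 * m + 1 \<or> p = 6 * m + 5"
        using False le nd by presburger
      then have "p dvd ?k"
        by (elim disjE) (simp_all only: dvd_mult2 dvd_triv_right)
      then obtain l where l: "?k = p * l" by blast
      have "of_nat ?k * A_coeff m = of_nat p * (of_nat l * A_coeff m)"
        unfolding l by simp
      moreover have "p_cong p (of_nat p * (of_nat l * A_coeff m)) 0"
        using p IH(1) by (intro p_cong_mult_0 p_integral_mult) auto
      ultimately show ?thesis by (simp only:)
    qed
    from p_cong_divide[OF p(1) this np] show ?thesis unfolding eq by simp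
  qed
  ultimately show ?case by blast
qed

lemma gbinomial_Suc_step: "(a gchoose Suc n) = (a gchoose n) * (a - of_nat n) / of_nat (Suc n)"
  for a :: rat
  by (simp add: gbinomial_prod_rev field_simps)

text \<open>Modulo p, -1/2 is (p - 1)/2, and for n < p the recursion divides only by numbers prime
  to p.\<close>

lemma gbinomial_half_mod_p:
  assumes p: "prime p" "p \<ge> 5" and "n < p"
  shows "p_integral p ((- 1 / 2) gchoose n) \<and>
    p_cong p ((- 1 / 2) gchoose n) (of_nat (((p - 1) div 2) choose n))"
  using \<open>n < p\<close>
proof (induction n)
  case 0
  then show ?case using p by simp
next
  case (Suc n)
  let ?r = "(p - 1) div 2"
  have "\<not> 2 dvd p" using p primes_dvd_imp_eq[of 2 p] by auto
  then have "p = 2 * ?r + 1" using p by presburger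
  then have "(of_nat p :: rat) = of_nat (2 * ?r + 1)" by (rule arg_cong)
  then have r: "(of_nat ?r :: rat) = - 1 / 2 + of_nat p / 2"
    unfolding of_nat_add of_nat_mult by linarith
  have np: "\<not> p dvd Suc n" using Suc.prems by (auto dest: dvd_imp_le)
  have n2: "\<not> p dvd 2" using p by (auto dest: dvd_imp_le)
  have half: "p_integral p (x / 2)" if "p_integral p x" for x
    using p_integral_divide[OF p(1) that n2] by simp
  have int: "p_integral p (- 1 / 2 - of_nat n)"
    using half[OF p_integral_minus[OF p(1) p_integral_numeral(2)[OF p(1)]]] p
    by (auto intro!: p_integral_diff)
  have IH: "p_integral p ((- 1 / 2) gchoose n)"
    "p_cong p ((- 1 / 2) gchoose n) (of_nat (?r choose n))"
    using Suc by auto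
  have "p_cong p (- 1 / 2 - of_nat n) (of_nat ?r - of_nat n)"
    unfolding r p_cong_def
    using half[OF p_integral_minus[OF p(1) p_integral_numeral(2)[OF p(1)]]] prime_gt_0_nat[OF p(1)]
    by (simp add: field_simps)
  then have "p_cong p (of_nat (?r choose n) * (- 1 / 2 - of_nat n))
      (of_nat (?r choose n) * (of_nat ?r - of_nat n))"
    using p by (intro p_cong_mult_left) auto
  with p_cong_mult_right[OF p(1) IH(2) int]
  have "p_cong p (((- 1 / 2) gchoose n) * (- 1 / 2 - of_nat n))
      (of_nat (?r choose n) * (of_nat ?r - of_nat n))"
    using p_cong_trans p by blast
  from p_cong_divide[OF p(1) this np]
  show ?case
    using p_integral_divide[OF p(1) p_integral_mult[OF p(1) IH(1) int] np]
    unfolding binomial_gbinomial gbinomial_Suc_step by blast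
qed

text \<open>With r = (p - 1)/2, W reduces to (1 - 1728 X)^r. Since r is at most N, the coefficient
  of X^N after division by 1 - c X is c^N times the value of this polynomial at 1/c.\<close>

lemma W_mult_G_nth_mod_p:
  assumes p: "prime p" "p \<ge> 5" and c: "p_integral p c" and N: "N < p" "(p - 1) div 2 \<le> N"
  shows "p_cong p ((W_fps * G_fps c) $ N)
    (c ^ (N - (p - 1) div 2) * (c - 1728) ^ ((p - 1) div 2))"
proof -
  let ?r = "(p - 1) div 2"
  have "p_cong p (\<Sum>l=0..N. (- 1728) ^ l * ((- 1 / 2) gchoose l) * c ^ (N - l))
     (\<Sum>l=0..N. (- 1728) ^ l * of_nat (?r choose l) * c ^ (N - l))"
    using p c N gbinomial_half_mod_p[OF p]
    by (intro p_cong_sum p_cong_mult_left p_cong_mult_right p_integral_power p_integral_minus) auto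
  also have "(\<Sum>l=0..N. (- 1728) ^ l * ((- 1 / 2) gchoose l) * c ^ (N - l)) = (W_fps * G_fps c) $ N"
    by (simp add: fps_mult_nth W_fps_nth G_fps_def)
  also have "(\<Sum>l=0..N. (- 1728) ^ l * of_nat (?r choose l) * c ^ (N - l)) =
      (\<Sum>l\<in>{..?r}. (- 1728) ^ l * of_nat (?r choose l) * c ^ (N - l))"
    using N by (intro sum.mono_neutral_right) (auto simp: binomial_eq_0)
  also have "\<dots> = (\<Sum>l\<in>{..?r}. c ^ (N - ?r) * (of_nat (?r choose l) * (- 1728) ^ l * c ^ (?r - l)))"
    using N by (intro sum.cong) (auto simp flip: power_add)
  also have "\<dots> = c ^ (N - ?r) * (- 1728 + c) ^ ?r"
    by (subst binomial_ring) (simp add: sum_distrib_left)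
  finally show ?thesis by simp
qed

theorem theorem1p6:
  fixes c :: rat and p :: nat
  assumes "prime p" and "p \<ge> 5"
    and "c \<noteq> 0" and "padic_val p c = 0"
  shows "rat_cong p
     (fls_nth (E4 / (j_invariant - fls_const c)) (int p))
     ((c * (c - 1728)) ^ ((p - 1) div 2) *
       (\<Sum>m = 0..p - 1. fact (6 * m) / (fact m ^ 3 * fact (3 * m)) * c powi (- int m)))"
proof (rule p_cong_imp_rat_cong)
  note p = assms(1,2)
  let ?r = "(p - 1) div 2" and ?U = "S_fps * (W_fps * G_fps c)"
  note c = p_integral_if_padic_val_0[OF assms(1,3,4)]
  have p_pos: "p > 0" using p by simp
  have WG: "p_integral p ((W_fps * G_fps c) $ n)" if "n < p" for n
    using that p c gbinomial_half_mod_p[OF p]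
    by (intro p_integral_fps_mult_nth)
      (auto simp: W_fps_nth G_fps_def intro!: p_integral_mult p_integral_power p_integral_minus)
  have U: "p_integral p (?U $ n)" if "n < p" for n
    using that p WG A_coeff_mod_p[OF p]
    by (intro p_integral_fps_mult_nth[of p n S_fps "W_fps * G_fps c"]) (auto simp: S_fps_def)

  \<comment> \<open>All denominators \<open>i\<close> are below p, so the factor p in
    \<open>E4_quotient_nth\<close> makes this sum vanish modulo p.\<close>
  have "p_integral p (\<Sum>i\<in>{1..<p}. ?U $ (i - 1) / of_nat i * (t_fps ^ i) $ p)"
    using p by (intro p_integral_sum p_integral_mult p_integral_divide p_integral_fps_power_nth
        p_integral_t_fps U) (auto dest: dvd_imp_le)
  from p_cong_add[OF p(1) p_cong_refl[OF p(1)] p_cong_mult_0[OF p(1) this], of "?U $ (p - 1)"]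
  have "p_cong p (fls_nth (E4 / (j_invariant - fls_const c)) (int p)) (?U $ (p - 1))"
    by (simp only: E4_quotient_nth[OF p_pos] add_0_right)
  moreover have "p_cong p (?U $ (p - 1))
     ((c * (c - 1728)) ^ ?r * (\<Sum>m = 0..p - 1. A_coeff m * c powi (- int m)))"
    unfolding fps_mult_nth[of S_fps] sum_distrib_left
  proof (rule p_cong_sum[OF p(1)])
    fix m assume "m \<in> {0..p - 1}"
    then have m: "m < p" using p_pos by auto
    let ?B = "(W_fps * G_fps c) $ (p - 1 - m)" and ?C = "(c * (c - 1728)) ^ ?r * c powi (- int m)"
    have C: "p_integral p ?C"
      using p c by (auto simp: power_int_minus simp flip: power_inverse
          intro!: p_integral_mult p_integral_power p_integral_diff)
    have "p_cong p (A_coeff m * ?B) (A_coeff m * ?C)"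
    proof (cases "p \<le> 6 * m")
      \<comment> \<open>Both sides vanish modulo p together with \<open>A_coeff m\<close>; every m >
        \<open>?r\<close> falls under this case.\<close>
      case True
      then have "p_cong p (A_coeff m) 0" using A_coeff_mod_p[OF p m] by simp
      from p_cong_mult_right[OF p(1) this C] p_cong_mult_right[OF p(1) this WG, of "p - 1 - m"] p_pos
      have "p_cong p (A_coeff m * ?C) 0" "p_cong p (A_coeff m * ?B) 0" by simp_all
      then show ?thesis
        using p_cong_trans[OF p(1)] p_cong_sym[OF p(1)] by blast
    next
      case False
      have "\<not> 2 dvd p" using p primes_dvd_imp_eq[of 2 p] by auto
      then have r: "p - 1 = 2 * ?r" by presburger
      \<comment> \<open>This bound makes the index p - 1 - m at least \<open>?r\<close>, as
        \<open>W_mult_G_nth_mod_p\<close> requires.\<close>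
      have mr: "m \<le> ?r" using False by linarith
      have "p_cong p ?B (c ^ (p - 1 - m - ?r) * (c - 1728) ^ ?r)"
        by (rule W_mult_G_nth_mod_p[OF p c(1)]) (use mr r p_pos in linarith)+
      also have "p - 1 - m - ?r = ?r - m" using r by linarith
      also have "c ^ (?r - m) * (c - 1728) ^ ?r = ?C"
        using mr assms(3) by (simp add: power_int_minus power_diff power_mult_distrib divide_inverse mult_ac)
      finally show ?thesis
        using A_coeff_mod_p[OF p m] p by (intro p_cong_mult_left) auto
    qed
    then show "p_cong p (S_fps $ m * ?B) ((c * (c - 1728)) ^ ?r * (A_coeff m * c powi (- int m)))"
      by (simp add: S_fps_def mult_ac)
  qed
  ultimately show "p_cong p (fls_nth (E4 / (j_invariant - fls_const c)) (int p))
     ((c * (c - 1728)) ^ ?r *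
       (\<Sum>m = 0..p - 1. fact (6 * m) / (fact m ^ 3 * fact (3 * m)) * c powi (- int m)))"
    using p_cong_trans[OF p(1)] unfolding A_coeff_def by blast
qed (rule assms(1))

end
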